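(* Suppose that the dual of (P) has the error bound property. Let $\kappa>0$ be a constant such that $\|x-\bar x\|\le\kappa\|\nabla^+d(x)\|$ for all $x\in\mathcal{K}^*$ with $f^*-d(x)\le f^*-d(x^{0,0})$, and let $(x^{k,j},y^{k,j})$ be generated by Algorithm (R-DFG) with $c=1/e$, i.e. with restart interval $K_c=\lfloor 2e\kappa\rfloor$. Then Algorithm (R-DFG) converges linearly in dual objective values: for every $\epsilon>0$ and every integer number of restarts $p\ge1$ whose total number of iterations $k=pK_c$ satisfies $$pK_c\ \ge\ e\,\kappa\,\log\frac{L_{\mathrm d}\mathcal{R}_{\mathrm d}^2}{\epsilon},$$ one has $$f^*-d(x^{K_c,p-1})\le\epsilon .$$ (If $\mathcal{R}_{\mathrm d}=0$, the right-hand side of the condition on $p$ is read as $-\infty$.)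
   Context: Problem (P): $f^* = \min_{u \in U} f(u)$ subject to $Gu + g \in \mathcal{K}$, where $f:\mathbb{R}^n \to \mathbb{R}$ is $\sigma_{\mathrm f}$-strongly convex with respect to the Euclidean norm $\|\cdot\|$ ($\sigma_{\mathrm f}>0$), $G \in \mathbb{R}^{p'\times n}$ ($G\ne 0$), $g \in \mathbb{R}^{p'}$, $\mathcal{K}\subseteq\mathbb{R}^{p'}$ is a proper cone (closed, convex, pointed, nonempty interior), and $U \subseteq \mathbb{R}^n$ is a nonempty closed convex set. $\mathcal{K}^* = \{x : \langle x,z\rangle \ge 0\ \forall z\in\mathcal{K}\}$ is the dual cone. The Lagrangian is $\mathcal{L}(u,x) = f(u) - \langle x, Gu+g\rangle$, the dual function is $d(x) = \min_{u\in U}\mathcal{L}(u,x)$ for $x \in \mathbb{R}^{p'}$, and $u(x)$ is the unique minimizer of $\mathcal{L}(\cdot,x)$ over $U$. The function $d$ is concave and differentiable on $\mathbb{R}^{p'}$ with $\nabla d(x) = -Gu(x)-g$, Lipschitz with constant $L_{\mathrm d} = \|G\|^2/\sigma_{\mathrm f}$ ($\|G\|$ the spectral norm). Standing assumption: there exists a finite optimal Lagrange multiplier for the conic constraint, so that $f^* = \max_{x\in\mathcal{K}^*} d(x)$ and the set $X^*\subseteq\mathcal{K}^*$ of maximizers is nonempty. $[z]_C$ denotes Euclidean projection onto $C$; $\bar x=[x]_{X^*}$; $\mathcal{R}_{\mathrm d}=\min_{x^*\in X^*}\|x^{0,0}-x^*\|$; the gradient map is $\nabla^+d(x)=\left[x+\frac1{L_{\mathrm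 d}}\nabla d(x)\right]_{\mathcal{K}^*}-x$. Error bound property: for every $M>0$ there exists $\kappa>0$ (depending on $M$ and the problem data) such that $\|x-\bar x\|\le\kappa\|\nabla^+d(x)\|$ for all $x\in\mathcal{K}^*$ with $f^*-d(x)\le M$. Algorithm (DFG): given $x^0=y^1\in\mathcal{K}^*$ and $\theta_1=1$, for $k\ge1$ compute $u^k=u(y^k)$, $x^k=\left[y^k+\frac{1}{L_{\mathrm d}}\nabla d(y^k)\right]_{\mathcal{K}^*}$, $\theta_{k+1}=\frac{1+\sqrt{1+4\theta_k^2}}{2}$, and $y^{k+1}=x^k+\frac{\theta_k-1}{\theta_{k+1}}(x^k-x^{k-1})$. Algorithm (R-DFG): given $x^{0,0}=y^{1,0}\in\mathcal{K}^*$ and a restart interval $K_c=\lfloor 2\kappa/c\rfloor$ with $c\in(0,1)$, for $j\ge0$: run Algorithm (DFG) for $K_c$ iterations starting from $x^{0,j}=y^{1,j}$, producing iterates $x^{k,j},y^{k,j}$ and finally $x^{K_c,j}$; then restart with $x^{0,j+1}=x^{K_c,j}$, $y^{1,j+1}=x^{K_c,j}$ and $\theta_1=1$. *)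

theory Defs
  imports "HOL-Analysis.Analysis"
begin

definition strongly_convex :: "real \<Rightarrow> ('a::real_normed_vector \<Rightarrow> real) \<Rightarrow> bool" where
  "strongly_convex \<sigma> f \<longleftrightarrow>
     (\<forall>x y. \<forall>t\<in>{0..1}.
        f (t *\<^sub>R x + (1 - t) *\<^sub>R y)
          \<le> t * f x + (1 - t) * f y - \<sigma> / 2 * t * (1 - t) * (norm (x - y))\<^sup>2)"

definition proper_cone :: "'a::euclidean_space set \<Rightarrow> bool" where
  "proper_cone K \<longleftrightarrow>
     cone K \<and> closed K \<and> convex K \<and> (\<forall>z. z \<in> K \<and> - z \<in> K \<longrightarrow> z = 0) \<and> interior K \<noteq> {}"

definition dual_cone :: "'a::real_inner set \<Rightarrow> 'a set" where
  "dual_cone K = {x. \<forall>z\<in>K. x \<bullet> z \<ge> 0}"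

definition gradient :: "('a::real_inner \<Rightarrow> real) \<Rightarrow> 'a \<Rightarrow> 'a" where
  "gradient F x = (THE D. GDERIV F x :> D)"

text \<open>
  The problem data are passed in the order \<open>f \<sigma> G g K U\<close>: minimize \<open>f u\<close> over \<open>u \<in> U\<close>
  subject to \<open>G *v u + g \<in> K\<close>, with \<open>f\<close> strongly convex with parameter \<open>\<sigma>\<close>.
\<close>

definition feasible_set ::
    "real^'n^'p \<Rightarrow> real^'p \<Rightarrow> (real^'p) set \<Rightarrow> (real^'n) set \<Rightarrow> (real^'n) set" where
  "feasible_set G g K U = {u \<in> U. G *v u + g \<in> K}"

definition opt_val ::
    "(real^'n \<Rightarrow> real) \<Rightarrow> real^'n^'p \<Rightarrow> real^'p \<Rightarrow> (real^'p) set \<Rightarrow> (real^'n) set \<Rightarrow> real" where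
  "opt_val f G g K U = (INF u\<in>feasible_set G g K U. f u)"

definition lagrangian ::
    "(real^'n \<Rightarrow> real) \<Rightarrow> real^'n^'p \<Rightarrow> real^'p \<Rightarrow> real^'n \<Rightarrow> real^'p \<Rightarrow> real" where
  "lagrangian f G g u x = f u - x \<bullet> (G *v u + g)"

text \<open>
  The two infima, here and in \<open>opt_val\<close>, are minima: for \<open>U\<close> closed, convex and nonempty, the
  strongly convex objective attains its infimum over \<open>U\<close>, and over the feasible set if that is
  nonempty.
\<close>

definition dual_fun ::
    "(real^'n \<Rightarrow> real) \<Rightarrow> real^'n^'p \<Rightarrow> real^'p \<Rightarrow> (real^'n) set \<Rightarrow> real^'p \<Rightarrow> real" where
  "dual_fun f G g U x = (INF u\<in>U. lagrangian f G g u x)"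

definition lagrangian_minimizer ::
    "(real^'n \<Rightarrow> real) \<Rightarrow> real^'n^'p \<Rightarrow> real^'p \<Rightarrow> (real^'n) set \<Rightarrow> real^'p \<Rightarrow> real^'n" where
  "lagrangian_minimizer f G g U x =
     (THE u. is_arg_min (\<lambda>v. lagrangian f G g v x) (\<lambda>v. v \<in> U) u)"

definition lagrange_multiplier ::
    "(real^'n \<Rightarrow> real) \<Rightarrow> real^'n^'p \<Rightarrow> real^'p \<Rightarrow> (real^'p) set \<Rightarrow> (real^'n) set
      \<Rightarrow> real^'p \<Rightarrow> bool" where
  "lagrange_multiplier f G g K U x \<longleftrightarrow>
     x \<in> dual_cone K \<and> dual_fun f G g U x = opt_val f G g K U"

definition dual_solutions ::
    "(real^'n \<Rightarrow> real) \<Rightarrow> real^'n^'p \<Rightarrow> real^'p \<Rightarrow> (real^'p) set \<Rightarrow> (real^'n) set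
      \<Rightarrow> (real^'p) set" where
  "dual_solutions f G g K U =
     {x \<in> dual_cone K. \<forall>z\<in>dual_cone K. dual_fun f G g U z \<le> dual_fun f G g U x}"

definition dual_lipschitz :: "real \<Rightarrow> real^'n^'p \<Rightarrow> real" where
  "dual_lipschitz \<sigma> G = (onorm ((*v) G))\<^sup>2 / \<sigma>"

definition projected_step ::
    "(real^'n \<Rightarrow> real) \<Rightarrow> real \<Rightarrow> real^'n^'p \<Rightarrow> real^'p \<Rightarrow> (real^'p) set \<Rightarrow> (real^'n) set
      \<Rightarrow> real^'p \<Rightarrow> real^'p" where
  "projected_step f \<sigma> G g K U x =
     closest_point (dual_cone K)
       (x + (1 / dual_lipschitz \<sigma> G) *\<^sub>R gradient (dual_fun f G g U) x)"

definition gradient_map ::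
    "(real^'n \<Rightarrow> real) \<Rightarrow> real \<Rightarrow> real^'n^'p \<Rightarrow> real^'p \<Rightarrow> (real^'p) set \<Rightarrow> (real^'n) set
      \<Rightarrow> real^'p \<Rightarrow> real^'p" where
  "gradient_map f \<sigma> G g K U x = projected_step f \<sigma> G g K U x - x"

definition error_bound ::
    "(real^'n \<Rightarrow> real) \<Rightarrow> real \<Rightarrow> real^'n^'p \<Rightarrow> real^'p \<Rightarrow> (real^'p) set \<Rightarrow> (real^'n) set
      \<Rightarrow> real \<Rightarrow> real \<Rightarrow> bool" where
  "error_bound f \<sigma> G g K U M \<kappa> \<longleftrightarrow>
     (\<forall>x\<in>dual_cone K. opt_val f G g K U - dual_fun f G g U x \<le> M \<longrightarrow>
        norm (x - closest_point (dual_solutions f G g K U) x)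
          \<le> \<kappa> * norm (gradient_map f \<sigma> G g K U x))"

definition error_bound_property ::
    "(real^'n \<Rightarrow> real) \<Rightarrow> real \<Rightarrow> real^'n^'p \<Rightarrow> real^'p \<Rightarrow> (real^'p) set \<Rightarrow> (real^'n) set
      \<Rightarrow> bool" where
  "error_bound_property f \<sigma> G g K U \<longleftrightarrow> (\<forall>M>0. \<exists>\<kappa>>0. error_bound f \<sigma> G g K U M \<kappa>)"

text \<open>
  The algorithm only uses the parameters from index 1 on; starting the recursion at
  \<open>\<theta>\<^sub>0 = 0\<close> yields \<open>\<theta>\<^sub>1 = 1\<close>.
\<close>

primrec dfg_theta :: "nat \<Rightarrow> real" where
  "dfg_theta 0 = 0"
| "dfg_theta (Suc k) = (1 + sqrt (1 + 4 * (dfg_theta k)\<^sup>2)) / 2"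

lemma dfg_theta_1: "dfg_theta 1 = 1"
  by simp

text \<open>
  \<open>dfg_run f \<sigma> G g K U N u x y\<close>: the sequences \<open>x 0, \<dots>, x N\<close>, \<open>y 1, \<dots>, y (N + 1)\<close> and
  \<open>u 1, \<dots>, u N\<close> are the result of \<open>N\<close> iterations of the dual fast gradient method; the values at
  other indices are irrelevant.
\<close>

definition dfg_run ::
    "(real^'n \<Rightarrow> real) \<Rightarrow> real \<Rightarrow> real^'n^'p \<Rightarrow> real^'p \<Rightarrow> (real^'p) set \<Rightarrow> (real^'n) set
      \<Rightarrow> nat \<Rightarrow> (nat \<Rightarrow> real^'n) \<Rightarrow> (nat \<Rightarrow> real^'p) \<Rightarrow> (nat \<Rightarrow> real^'p) \<Rightarrow> bool" where
  "dfg_run f \<sigma> G g K U N u x y \<longleftrightarrow>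
     x 0 \<in> dual_cone K \<and> y 1 = x 0 \<and>
     (\<forall>k\<in>{1..N}.
        u k = lagrangian_minimizer f G g U (y k) \<and>
        x k = projected_step f \<sigma> G g K U (y k) \<and>
        y (k + 1) = x k + ((dfg_theta k - 1) / dfg_theta (k + 1)) *\<^sub>R (x k - x (k - 1)))"

definition restart_interval :: "real \<Rightarrow> real \<Rightarrow> nat" where
  "restart_interval \<kappa> c = nat \<lfloor>2 * \<kappa> / c\<rfloor>"

text \<open>
  Here \<open>x k j\<close> is the \<open>k\<close>-th iterate after the \<open>j\<close>-th restart. Each run uses
  \<open>dfg_theta\<close> from index 1, so the parameters are reset as well.
\<close>

definition restarted_dfg_run ::
    "(real^'n \<Rightarrow> real) \<Rightarrow> real \<Rightarrow> real^'n^'p \<Rightarrow> real^'p \<Rightarrow> (real^'p) set \<Rightarrow> (real^'n) set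
      \<Rightarrow> nat \<Rightarrow> (nat \<Rightarrow> nat \<Rightarrow> real^'n) \<Rightarrow> (nat \<Rightarrow> nat \<Rightarrow> real^'p) \<Rightarrow> (nat \<Rightarrow> nat \<Rightarrow> real^'p)
      \<Rightarrow> bool" where
  "restarted_dfg_run f \<sigma> G g K U N u x y \<longleftrightarrow>
     (\<forall>j. dfg_run f \<sigma> G g K U N (\<lambda>k. u k j) (\<lambda>k. x k j) (\<lambda>k. y k j) \<and>
          x 0 (j + 1) = x N j \<and> y 1 (j + 1) = x N j)"

end

theory Submission
  imports Defs
begin

text \<open>
  Write \<open>d\<close> for the dual function, \<open>L\<close> for its Lipschitz constant, \<open>N\<close> for the restart interval,
  \<open>gap\<close> for the distance of \<open>d\<close> from the optimal value, and \<open>dist\<close> for the distance to the set of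
  dual solutions. A maximizer of the dual has value \<open>opt_val\<close>, by weak duality and the existence of
  a multiplier.

  Strong convexity makes the minimizer of the Lagrangian stable, so \<open>d\<close> lies between its tangents
  and those tangents lowered by \<open>L/2\<close> times the squared distance
  (\<open>dual_fun_smooth_concave\<close>). For such a function, one accelerated run of length \<open>N\<close>
  started at \<open>x\<close> ends with gap at most \<open>2 L dist(x)\<^sup>2 / (N + 1)\<^sup>2\<close> (\<open>accelerated_rate\<close>).
  Conversely, a single gradient step gains \<open>L/2\<close> times its squared length, so the error bound gives
  \<open>dist(x)\<^sup>2 \<le> \<kappa>\<^sup>2 (2 / L) gap(x)\<close>. The two together show that a run multiplies the gap by at
  most \<open>(2 \<kappa> / (N + 1))\<^sup>2\<close> (\<open>accelerated_contraction\<close>), which is at most \<open>exp (- 2)\<close> because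
  \<open>N + 1 > 2 e \<kappa>\<close>. In particular the gap never grows from one restart to the next, so the error
  bound, which is known on the initial superlevel set, applies to every restart point.

  The first run needs a separate estimate in terms of the distance \<open>R\<close> of the starting point, since
  the initial gap need not be bounded by a multiple of \<open>L R\<^sup>2\<close>: the gradient does not vanish at a
  constrained maximizer. The rate gives \<open>2 L R\<^sup>2 / (N + 1)\<^sup>2\<close> after that run, and to reach
  \<open>exp (- 2) L R\<^sup>2\<close> one needs \<open>2 e\<^sup>2 \<le> (N + 1)\<^sup>2\<close>. This holds because \<open>\<kappa>\<close> cannot be small: the
  gradient map at any point is at most \<open>\<surd>2\<close> times as long as the distance to a maximizer
  (\<open>step_displacement\<close>), so the error bound at a point that is not optimal forces
  \<open>2 \<kappa>\<^sup>2 \<ge> 1\<close>. Hence the gap after \<open>p\<close> runs is at most \<open>exp (- 2 p) L R\<^sup>2\<close>, and the hypothesis on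
  \<open>p\<close> with \<open>N \<le> 2 e \<kappa>\<close> makes this at most \<open>\<epsilon>\<close>. If the starting point is already optimal, so are
  all restart points.
\<close>

section \<open>Minimizers of strongly convex functions\<close>

lemma strongly_convexD:
  assumes "strongly_convex \<sigma> f" "0 \<le> t" "t \<le> 1"
  shows "f (t *\<^sub>R x + (1 - t) *\<^sub>R y)
    \<le> t * f x + (1 - t) * f y - \<sigma> / 2 * t * (1 - t) * (norm (x - y))\<^sup>2"
  using assms unfolding strongly_convex_def by simp

lemma strongly_convex_imp_convex_on:
  fixes f :: "'a::real_normed_vector \<Rightarrow> real"
  assumes "strongly_convex \<sigma> f" "\<sigma> > 0"
  shows "convex_on UNIV f"
proof (rule convex_onI)
  fix t :: real and x y :: 'a
  assume t: "0 < t" "t < 1"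
  have "0 \<le> \<sigma> / 2 * (1 - t) * (1 - (1 - t)) * (norm (x - y))\<^sup>2"
    using t assms(2) by (intro mult_nonneg_nonneg) auto
  moreover have "f ((1 - t) *\<^sub>R x + (1 - (1 - t)) *\<^sub>R y)
      \<le> (1 - t) * f x + (1 - (1 - t)) * f y - \<sigma> / 2 * (1 - t) * (1 - (1 - t)) * (norm (x - y))\<^sup>2"
    using t by (intro strongly_convexD[OF assms(1)]) auto
  ultimately show "f ((1 - t) *\<^sub>R x + t *\<^sub>R y) \<le> (1 - t) * f x + t * f y"
    by simp
qed simp

text \<open>
  Comparing the minimizer with the points of the segment towards \<open>u\<close> bounds \<open>f u - f v\<close> from below
  by \<open>\<sigma>/2 (1 - t)\<close> times the squared distance; the bound improves as the point approaches the
  minimizer, and the claim is the limit \<open>t \<rightarrow> 0\<close>.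
\<close>

lemma strongly_convex_minimizer_growth:
  fixes f :: "'a::real_normed_vector \<Rightarrow> real"
  assumes f: "strongly_convex \<sigma> f" and U: "convex U" "v \<in> U" "u \<in> U"
    and min: "\<And>w. w \<in> U \<Longrightarrow> f v \<le> f w"
  shows "f v + \<sigma> / 2 * (norm (u - v))\<^sup>2 \<le> f u"
proof -
  have le: "\<sigma> / 2 * (1 - t) * (norm (u - v))\<^sup>2 \<le> f u - f v" if t: "0 < t" "t < 1" for t
  proof -
    have "t *\<^sub>R u + (1 - t) *\<^sub>R v \<in> U"
      using U t by (intro convexD) auto
    then have "f v \<le> f (t *\<^sub>R u + (1 - t) *\<^sub>R v)"
      by (rule min)
    also have "\<dots> \<le> t * f u + (1 - t) * f v - \<sigma> / 2 * t * (1 - t) * (norm (u - v))\<^sup>2"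
      using t by (intro strongly_convexD[OF f]) auto
    finally have "t * (\<sigma> / 2 * (1 - t) * (norm (u - v))\<^sup>2) \<le> t * (f u - f v)"
      by (simp add: algebra_simps)
    then show ?thesis
      using t by simp
  qed
  have "((\<lambda>t. \<sigma> / 2 * (1 - t) * (norm (u - v))\<^sup>2) \<longlongrightarrow> \<sigma> / 2 * (1 - 0) * (norm (u - v))\<^sup>2) (at_right 0)"
    by (intro tendsto_intros)
  moreover have "\<forall>\<^sub>F t in at_right (0::real). \<sigma> / 2 * (1 - t) * (norm (u - v))\<^sup>2 \<le> f u - f v"
    by (rule eventually_at_rightI[of 0 1]) (use le in auto)
  ultimately have "\<sigma> / 2 * (1 - 0) * (norm (u - v))\<^sup>2 \<le> f u - f v"
    by (rule tendsto_upperbound) simp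
  then show ?thesis
    by simp
qed

text \<open>
  Existence by compactness: \<open>f\<close> is continuous, and its sublevel sets are bounded. For the latter, a
  far point \<open>w\<close> with \<open>f w \<le> f a\<close> would push the value on the unit sphere around \<open>a\<close>, at the point
  in the direction of \<open>w\<close>, below the minimum of \<open>f\<close> on the unit ball.
\<close>

lemma strongly_convex_attains_min:
  fixes f :: "'a::euclidean_space \<Rightarrow> real"
  assumes f: "strongly_convex \<sigma> f" and \<sigma>: "\<sigma> > 0" and U: "closed U" "U \<noteq> {}"
  obtains v where "v \<in> U" "\<And>w. w \<in> U \<Longrightarrow> f v \<le> f w"
proof -
  obtain a where a: "a \<in> U"
    using U by auto
  have cont: "continuous_on UNIV f"
    by (rule convex_on_continuous[OF open_UNIV strongly_convex_imp_convex_on[OF f \<sigma>]])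
  have "compact (cball a 1)" "cball a 1 \<noteq> {}" "continuous_on (cball a 1) f"
    using continuous_on_subset[OF cont] by auto
  then obtain b where b: "\<And>w. w \<in> cball a 1 \<Longrightarrow> f b \<le> f w"
    using continuous_attains_inf by metis
  define S where "S = {w \<in> U. f w \<le> f a}"
  have rad: "norm (w - a) \<le> 1 + 2 * (f a - f b) / \<sigma>" if w: "f w \<le> f a" for w
  proof (cases "norm (w - a) \<le> 1")
    case True
    moreover have "f b \<le> f a"
      by (rule b) simp
    ultimately show ?thesis
      using \<sigma> by (smt (verit) divide_nonneg_pos)
  next
    case False
    define r where "r = norm (w - a)"
    have r: "r > 1"
      using False by (simp add: r_def)
    have "f b \<le> f ((1 / r) *\<^sub>R w + (1 - 1 / r) *\<^sub>R a)"
    proof (rule b)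
      have "a - ((1 / r) *\<^sub>R w + (1 - 1 / r) *\<^sub>R a) = (1 / r) *\<^sub>R (a - w)"
        by (simp add: algebra_simps)
      then show "(1 / r) *\<^sub>R w + (1 - 1 / r) *\<^sub>R a \<in> cball a 1"
        using r by (simp add: dist_norm r_def norm_minus_commute)
    qed
    also have "\<dots> \<le> 1 / r * f w + (1 - 1 / r) * f a - \<sigma> / 2 * (1 / r) * (1 - 1 / r) * r\<^sup>2"
      unfolding r_def using r[unfolded r_def] by (intro strongly_convexD[OF f]) (auto simp: divide_le_eq_1)
    also have "\<dots> \<le> 1 / r * f a + (1 - 1 / r) * f a - \<sigma> / 2 * (1 / r) * (1 - 1 / r) * r\<^sup>2"
      using w r by (simp add: divide_right_mono)
    also have "\<dots> = f a - \<sigma> / 2 * (r - 1)"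
      using r by (simp add: field_simps power2_eq_square)
    finally show ?thesis
      unfolding r_def[symmetric] using \<sigma> by (simp add: field_simps)
  qed
  have "bounded S"
    by (rule boundedI[of _ "norm a + (1 + 2 * (f a - f b) / \<sigma>)"])
      (use rad S_def in \<open>smt (verit) mem_Collect_eq norm_triangle_sub\<close>)
  moreover have "closed S"
  proof -
    have "S = U \<inter> {w. f w \<le> f a}"
      by (auto simp: S_def)
    then show ?thesis
      using U cont by (simp add: closed_Int closed_Collect_le continuous_on_const)
  qed
  ultimately have "compact S"
    by (simp add: compact_eq_bounded_closed)
  moreover have "a \<in> S"
    using a by (simp add: S_def)
  moreover have "continuous_on S f"
    using cont continuous_on_subset by blast
  ultimately obtain v where "v \<in> S" "\<And>w. w \<in> S \<Longrightarrow> f v \<le> f w"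
    by (metis continuous_attains_inf empty_iff)
  then have "v \<in> U" "\<And>w. w \<in> U \<Longrightarrow> f v \<le> f w"
    using \<open>a \<in> S\<close> unfolding S_def by (auto, metis linear order_trans)
  then show ?thesis
    using that by blast
qed

section \<open>Projected gradient steps for smooth concave functions\<close>

text \<open>
  The two tangent bounds are all that the convergence analysis uses: the upper one is
  concavity, the lower one follows from a Lipschitz gradient. They force \<open>D\<close> to be the gradient.
\<close>

locale smooth_concave =
  fixes F :: "'a::euclidean_space \<Rightarrow> real" and D :: "'a \<Rightarrow> 'a" and L :: real
  assumes L_pos: "L > 0"
    and upper: "F z \<le> F y + D y \<bullet> (z - y)"
    and lower: "F y + D y \<bullet> (z - y) - L / 2 * (norm (z - y))\<^sup>2 \<le> F z"
begin

lemma GDERIV_supergradient: "GDERIV F y :> D y"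
  unfolding gderiv_def has_derivative_at
proof
  show "bounded_linear (\<lambda>h. h \<bullet> D y)"
    by (rule bounded_linear_inner_left)
  have quot: "norm (norm (F (y + h) - F y - h \<bullet> D y) / norm h) \<le> L / 2 * norm h" for h
  proof -
    have "F (y + h) - F y - h \<bullet> D y \<le> 0"
      using upper[of "y + h" y] by (simp add: inner_commute)
    moreover have "- (L / 2 * (norm h)\<^sup>2) \<le> F (y + h) - F y - h \<bullet> D y"
      using lower[of y "y + h"] by (simp add: inner_commute)
    ultimately have "\<bar>F (y + h) - F y - h \<bullet> D y\<bar> \<le> L / 2 * (norm h)\<^sup>2"
      by linarith
    then show ?thesis
      by (cases "h = 0") (simp_all add: power2_eq_square divide_simps mult.assoc)
  qed
  have "((\<lambda>h::'a. L / 2 * norm h) \<longlongrightarrow> L / 2 * norm (0::'a)) (at 0)"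
    by (intro tendsto_intros)
  then have "((\<lambda>h::'a. L / 2 * norm h) \<longlongrightarrow> 0) (at 0)"
    by simp
  then show "(\<lambda>h. norm (F (y + h) - F y - h \<bullet> D y) / norm h) \<midarrow>0\<rightarrow> 0"
    by (rule Lim_null_comparison[rotated]) (rule always_eventually, rule allI, rule quot)
qed

lemma gradient_eq: "gradient F y = D y"
  unfolding gradient_def
proof (rule the_equality)
  fix E assume "GDERIV F y :> E"
  then have "(\<lambda>h. h \<bullet> E) = (\<lambda>h. h \<bullet> D y)"
    using GDERIV_supergradient[of y] unfolding gderiv_def by (rule has_derivative_unique)
  then show "E = D y"
    by (metis vector_eq_ldot)
qed (rule GDERIV_supergradient)

lemma continuous: "continuous_on S F"
  by (intro continuous_at_imp_continuous_on ballI)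
    (metis GDERIV_supergradient gderiv_def has_derivative_continuous)

lemma concave:
  assumes "0 \<le> t" "t \<le> 1"
  shows "(1 - t) * F a + t * F b \<le> F ((1 - t) *\<^sub>R a + t *\<^sub>R b)"
proof -
  define z where "z = (1 - t) *\<^sub>R a + t *\<^sub>R b"
  have "(1 - t) * F a \<le> (1 - t) * (F z + D z \<bullet> (a - z))"
    using assms upper by (intro mult_left_mono) auto
  moreover have "t * F b \<le> t * (F z + D z \<bullet> (b - z))"
    using assms upper by (intro mult_left_mono) auto
  moreover have "(1 - t) * (D z \<bullet> (a - z)) + t * (D z \<bullet> (b - z))
      = D z \<bullet> ((1 - t) *\<^sub>R (a - z) + t *\<^sub>R (b - z))"
    by (simp add: inner_add_right)
  moreover have "(1 - t) *\<^sub>R (a - z) + t *\<^sub>R (b - z) = 0"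
    unfolding z_def by (simp add: algebra_simps)
  ultimately have "(1 - t) * F a + t * F b \<le> (1 - t) * F z + t * F z"
    by (simp only: distrib_left) simp
  then show ?thesis
    unfolding z_def[symmetric] by (simp add: algebra_simps)
qed

text \<open>
  The Baillon--Haddad inequality. It comes from moving from \<open>a\<close> by \<open>(D a - D b) / L\<close>, the
  maximizer of the lower quadratic model at \<open>a\<close> minus the tangent at \<open>b\<close>, and comparing the two
  bounds there; the resulting inequality is added to the one with \<open>a\<close> and \<open>b\<close> exchanged.
\<close>

lemma cocoercive:
  "(norm (D w - D y))\<^sup>2 \<le> L * ((D y - D w) \<bullet> (w - y))"
proof -
  have half: "F a \<le> F b + D b \<bullet> (a - b) - (norm (D a - D b))\<^sup>2 / (2 * L)" for a b
  proof -
    define h where "h = (1 / L) *\<^sub>R (D a - D b)"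
    have "F a + D a \<bullet> h - L / 2 * (norm h)\<^sup>2 \<le> F (a + h)"
      using lower[of a "a + h"] by simp
    also have "\<dots> \<le> F b + D b \<bullet> (a - b) + D b \<bullet> h"
      using upper[of "a + h" b] by (simp add: inner_add_right inner_diff_right)
    finally have "F a \<le> F b + D b \<bullet> (a - b) - (D a - D b) \<bullet> h + L / 2 * (norm h)\<^sup>2"
      by (simp add: inner_diff_left)
    moreover have "(D a - D b) \<bullet> h = (norm (D a - D b))\<^sup>2 / L"
      unfolding h_def by (simp add: power2_norm_eq_inner)
    moreover have "L / 2 * (norm h)\<^sup>2 = (norm (D a - D b))\<^sup>2 / (2 * L)"
      unfolding h_def using L_pos by (simp add: power_mult_distrib power2_eq_square)
    ultimately show ?thesis
      using L_pos by (simp add: field_simps)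
  qed
  have "D w \<bullet> (y - w) = - (D w \<bullet> (w - y))"
    by (simp add: inner_diff_right)
  then have "(norm (D w - D y))\<^sup>2 / L \<le> (D y - D w) \<bullet> (w - y)"
    using half[of w y] half[of y w] L_pos
    by (simp add: norm_minus_commute inner_diff_left field_simps)
  then show ?thesis
    using L_pos by (simp add: field_simps)
qed

end

locale constrained_smooth_concave = smooth_concave F D L
  for F :: "'a::euclidean_space \<Rightarrow> real" and D :: "'a \<Rightarrow> 'a" and L :: real +
  fixes C :: "'a set"
  assumes C_convex: "convex C" and C_closed: "closed C" and C_nonempty: "C \<noteq> {}"
begin

definition step :: "'a \<Rightarrow> 'a" where
  "step y = closest_point C (y + (1 / L) *\<^sub>R D y)"

lemma step_in: "step y \<in> C"
  unfolding step_def by (rule closest_point_in_set[OF C_closed C_nonempty])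

lemma step_variational:
  assumes "z \<in> C"
  shows "(y + (1 / L) *\<^sub>R D y - step y) \<bullet> (z - step y) \<le> 0"
  unfolding step_def by (rule closest_point_dot[OF C_convex C_closed assms])

text \<open>
  The projected step maximizes over \<open>C\<close> the lower quadratic model of \<open>F\<close> at \<open>y\<close>, and this model is
  strongly concave; concavity bounds \<open>F z\<close> by the tangent at \<open>y\<close>. The base point \<open>y\<close> may lie
  outside \<open>C\<close>, as the extrapolated points of the accelerated method do.
\<close>

lemma step_three_point:
  assumes "z \<in> C"
  shows "F z - F (step y) \<le> L / 2 * ((norm (z - y))\<^sup>2 - (norm (z - step y))\<^sup>2)"
proof -
  let ?s = "step y"
  have "L * ((y + (1 / L) *\<^sub>R D y - ?s) \<bullet> (z - ?s)) \<le> 0"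
    using step_variational[OF assms] L_pos by (simp add: mult_nonneg_nonpos)
  moreover have "L * ((y + (1 / L) *\<^sub>R D y - ?s) \<bullet> (z - ?s))
      = D y \<bullet> (z - ?s) - L * ((?s - y) \<bullet> (z - ?s))"
    using L_pos by (simp add: inner_add_left inner_diff_left algebra_simps)
  ultimately have "D y \<bullet> (z - ?s) \<le> L * ((?s - y) \<bullet> (z - ?s))"
    by linarith
  moreover have "F z - F ?s \<le> D y \<bullet> (z - ?s) + L / 2 * (norm (?s - y))\<^sup>2"
    using upper[of z y] lower[of y ?s] by (simp add: inner_diff_right)
  moreover have "L * ((?s - y) \<bullet> (z - ?s)) + L / 2 * (norm (?s - y))\<^sup>2
      = L / 2 * ((norm (z - y))\<^sup>2 - (norm (z - ?s))\<^sup>2)"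
    unfolding power2_norm_eq_inner
    by (simp add: inner_diff_left inner_diff_right inner_commute algebra_simps)
  ultimately show ?thesis
    by linarith
qed

lemma step_ascent:
  assumes "y \<in> C"
  shows "L / 2 * (norm (step y - y))\<^sup>2 \<le> F (step y) - F y"
  using step_three_point[OF assms, of y] by (simp add: norm_minus_commute)

lemma step_maximizer:
  assumes "s \<in> C" and max: "\<And>z. z \<in> C \<Longrightarrow> F z \<le> F s"
  shows "step s = s"
proof -
  have "L / 2 * (norm (step s - s))\<^sup>2 \<le> 0"
    using step_ascent[OF assms(1)] max[OF step_in, of s] by linarith
  then show ?thesis
    using L_pos by (simp add: mult_le_0_iff)
qed

text \<open>
  Let \<open>a = s - y\<close>, let \<open>q\<close> be its image under the gradient step and \<open>c = s - step y\<close> its image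
  under the whole step, which fixes \<open>s\<close>. Both the gradient step (by cocoercivity) and the
  projection are firmly nonexpansive, that is \<open>q \<bullet> q \<le> q \<bullet> a\<close> and \<open>c \<bullet> c \<le> q \<bullet> c\<close>. These two
  inequalities bound \<open>norm (c - a)\<close>, the length of the step. The triangle inequality would only give
  the factor \<open>4\<close> in place of \<open>2\<close>, and the estimate for the first run of the restarted method
  depends on the better factor.
\<close>

lemma step_displacement:
  assumes "s \<in> C" and "\<And>z. z \<in> C \<Longrightarrow> F z \<le> F s"
  shows "(norm (step y - y))\<^sup>2 \<le> 2 * (norm (s - y))\<^sup>2"
proof -
  define a where "a = s - y"
  define q where "q = a + (1 / L) *\<^sub>R (D s - D y)"
  define c where "c = s - step y"
  have fix_s: "step s = s"
    by (rule step_maximizer) (use assms in auto)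
  have "0 \<le> (D y - D s) \<bullet> (L *\<^sub>R a) - (norm (D s - D y))\<^sup>2"
    using cocoercive[of s y] unfolding a_def by simp
  moreover have "D s - D y = L *\<^sub>R (q - a)"
    unfolding q_def using L_pos by simp
  moreover from this have "D y - D s = L *\<^sub>R (a - q)"
    by (metis minus_diff_eq scaleR_minus_right)
  ultimately have "0 \<le> (L *\<^sub>R (a - q)) \<bullet> (L *\<^sub>R a) - (norm (L *\<^sub>R (q - a)))\<^sup>2"
    by simp
  also have "\<dots> = L\<^sup>2 * ((a - q) \<bullet> a - (norm (q - a))\<^sup>2)"
    unfolding norm_scaleR power_mult_distrib power2_abs
    by (simp add: power2_eq_square right_diff_distrib)
  finally have "0 \<le> L\<^sup>2 * ((a - q) \<bullet> a - (norm (q - a))\<^sup>2)" .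
  then have "0 \<le> (a - q) \<bullet> a - (norm (q - a))\<^sup>2"
    using L_pos by (simp add: zero_le_mult_iff)
  then have qa: "0 \<le> q \<bullet> a - q \<bullet> q"
    unfolding power2_norm_eq_inner by (simp add: inner_diff_left inner_diff_right inner_commute)
  have "(y + (1 / L) *\<^sub>R D y - step y) \<bullet> c \<le> 0"
    unfolding c_def by (rule step_variational[OF assms(1)])
  moreover have "0 \<le> (s + (1 / L) *\<^sub>R D s - s) \<bullet> c"
    using step_variational[OF step_in, of s y] unfolding fix_s c_def
    by (simp add: inner_diff_right)
  moreover have "(s + (1 / L) *\<^sub>R D s - s) - (y + (1 / L) *\<^sub>R D y - step y) = q - c"
    unfolding q_def a_def c_def by (simp add: algebra_simps)
  ultimately have "0 \<le> (q - c) \<bullet> c"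
    by (metis add.inverse_neutral diff_ge_0_iff_ge inner_diff_left order_trans)
  then have cq: "0 \<le> q \<bullet> c - c \<bullet> c"
    by (simp add: inner_diff_left)
  \<comment> \<open>A sum of squares certificate: the multiplier 3 of both inequalities makes the remaining
    quadratic form in a, c and q nonnegative.\<close>
  have "2 * (a \<bullet> a) - (c - a) \<bullet> (c - a)
      = 3 * (q \<bullet> c - c \<bullet> c) + 3 * (q \<bullet> a - q \<bullet> q)
        + (a + c - (3/2) *\<^sub>R q) \<bullet> (a + c - (3/2) *\<^sub>R q) + c \<bullet> c + (3/4) * (q \<bullet> q)"
    by (simp add: inner_diff_left inner_diff_right inner_add_left inner_add_right
        inner_commute algebra_simps)
  also have "\<dots> \<ge> 0"
    using cq qa by (intro add_nonneg_nonneg mult_nonneg_nonneg) auto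
  finally have "(norm (c - a))\<^sup>2 \<le> 2 * (norm a)\<^sup>2"
    unfolding power2_norm_eq_inner by simp
  moreover have "c - a = y - step y"
    unfolding c_def a_def by simp
  ultimately show ?thesis
    unfolding a_def by (simp add: norm_minus_commute)
qed

end

section \<open>The accelerated method\<close>

text \<open>
  The identity for which the recursion is chosen: it lets the potential of the accelerated method
  telescope.
\<close>

lemma dfg_theta_square: "(dfg_theta (Suc k))\<^sup>2 - dfg_theta (Suc k) = (dfg_theta k)\<^sup>2"
proof -
  have "(sqrt (1 + 4 * (dfg_theta k)\<^sup>2))\<^sup>2 = 1 + 4 * (dfg_theta k)\<^sup>2"
    by (intro real_sqrt_pow2) (auto intro: add_nonneg_nonneg)
  then show ?thesis
    by (simp add: power2_eq_square algebra_simps)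
qed

lemma dfg_theta_lower: "real (k + 2) / 2 \<le> dfg_theta (Suc k)"
proof (induction k)
  case 0
  then show ?case by simp
next
  case (Suc k)
  have "2 * dfg_theta (Suc k) \<le> sqrt (1 + 4 * (dfg_theta (Suc k))\<^sup>2)"
    by (rule real_le_rsqrt) (simp only: power_mult_distrib, simp)
  then have "1 / 2 + dfg_theta (Suc k) \<le> dfg_theta (Suc (Suc k))"
    unfolding dfg_theta.simps(2)[of "Suc k"] by simp
  with Suc.IH show ?case
    by simp
qed

context constrained_smooth_concave
begin

text \<open>
  The dual iterates of \<open>dfg_run\<close>, for a general objective and a general constraint set.
\<close>

definition accelerated_run :: "nat \<Rightarrow> (nat \<Rightarrow> 'a) \<Rightarrow> (nat \<Rightarrow> 'a) \<Rightarrow> bool" where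
  "accelerated_run N x y \<longleftrightarrow>
     x 0 \<in> C \<and> y 1 = x 0 \<and>
     (\<forall>k\<in>{1..N}. x k = step (y k) \<and>
        y (k + 1) = x k + ((dfg_theta k - 1) / dfg_theta (k + 1)) *\<^sub>R (x k - x (k - 1)))"

lemma accelerated_run_in:
  assumes "accelerated_run N x y" "k \<le> N"
  shows "x k \<in> C"
  using assms step_in unfolding accelerated_run_def by (cases k) auto

text \<open>
  The potential method for Nesterov acceleration. The three-point inequality is applied with the
  comparison point \<open>w = (1 - 1/t) x\<^sub>k + (1/t) z\<close>, which lies in \<open>C\<close> and whose value is controlled by
  concavity. After multiplication by \<open>t\<^sup>2\<close>, the vectors \<open>t (y - w)\<close> and \<open>t (x - w)\<close> are the old and
  the new vector in the potential (this is what the extrapolation formula is for), and the gap terms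
  match exactly by the identity for \<open>dfg_theta\<close>, whatever the sign of \<open>F z - F (x k)\<close>. With \<open>dfg_theta 0 = 0\<close> and \<open>y 1 = x 0\<close> the potential
  at \<open>k = 0\<close> equals the right-hand side.
\<close>

lemma accelerated_potential:
  assumes run: "accelerated_run N x y" and z: "z \<in> C" and "k \<le> N"
  shows "(dfg_theta k)\<^sup>2 * (F z - F (x k))
      + L / 2 * (norm (dfg_theta (Suc k) *\<^sub>R y (Suc k) - (dfg_theta (Suc k) - 1) *\<^sub>R x k - z))\<^sup>2
    \<le> L / 2 * (norm (x 0 - z))\<^sup>2"
  using \<open>k \<le> N\<close>
proof (induction k)
  case 0
  then show ?case
    using run by (simp add: accelerated_run_def)
next
  case (Suc k)
  define t where "t = dfg_theta (Suc k)"
  define t' where "t' = dfg_theta (Suc (Suc k))"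
  define v where "v = t *\<^sub>R y (Suc k) - (t - 1) *\<^sub>R x k - z"
  have t: "t \<ge> 1" and t': "t' > 0"
    using dfg_theta_lower[of k] dfg_theta_lower[of "Suc k"] unfolding t_def t'_def by simp_all
  have rel: "t\<^sup>2 - t = (dfg_theta k)\<^sup>2"
    unfolding t_def by (rule dfg_theta_square)
  have IH: "(t\<^sup>2 - t) * (F z - F (x k)) + L / 2 * (norm v)\<^sup>2 \<le> L / 2 * (norm (x 0 - z))\<^sup>2"
    using Suc unfolding rel by (simp add: t_def v_def)
  have xs: "x (Suc k) = step (y (Suc k))"
    and ys: "y (Suc (Suc k)) = x (Suc k) + ((t - 1) / t') *\<^sub>R (x (Suc k) - x k)"
    using run Suc.prems unfolding accelerated_run_def t_def t'_def by auto
  have v': "t' *\<^sub>R y (Suc (Suc k)) - (t' - 1) *\<^sub>R x (Suc k) - z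
      = t *\<^sub>R x (Suc k) - (t - 1) *\<^sub>R x k - z"
  proof -
    have "t' *\<^sub>R y (Suc (Suc k)) = t' *\<^sub>R x (Suc k) + (t - 1) *\<^sub>R (x (Suc k) - x k)"
      unfolding ys scaleR_add_right scaleR_scaleR using t' by simp
    then show ?thesis
      by (simp add: scaleR_diff_left scaleR_diff_right)
  qed
  define w where "w = (1 - 1 / t) *\<^sub>R x k + (1 / t) *\<^sub>R z"
  have tw: "t *\<^sub>R w = (t - 1) *\<^sub>R x k + z"
    unfolding w_def using t by (simp add: scaleR_add_right right_diff_distrib)
  have xk: "x k \<in> C"
    using run Suc.prems by (intro accelerated_run_in) auto
  have "w \<in> C"
    unfolding w_def using convexD[OF C_convex xk z, of "1 - 1 / t" "1 / t"] t by simp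
  then have "F w - F (x (Suc k)) \<le> L / 2 * ((norm (w - y (Suc k)))\<^sup>2 - (norm (w - x (Suc k)))\<^sup>2)"
    unfolding xs by (rule step_three_point)
  moreover have "(1 - 1 / t) * F (x k) + 1 / t * F z \<le> F w"
    unfolding w_def using t by (intro concave) auto
  ultimately have "(1 - 1 / t) * F (x k) + 1 / t * F z - F (x (Suc k))
      \<le> L / 2 * ((norm (w - y (Suc k)))\<^sup>2 - (norm (w - x (Suc k)))\<^sup>2)"
    by linarith
  then have "t\<^sup>2 * ((1 - 1 / t) * F (x k) + 1 / t * F z - F (x (Suc k)))
      \<le> t\<^sup>2 * (L / 2 * ((norm (w - y (Suc k)))\<^sup>2 - (norm (w - x (Suc k)))\<^sup>2))"
    by (rule mult_left_mono) simp
  moreover have "t\<^sup>2 * ((1 - 1 / t) * F (x k) + 1 / t * F z - F (x (Suc k)))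
      = t\<^sup>2 * (F z - F (x (Suc k))) - (t\<^sup>2 - t) * (F z - F (x k))"
    using t by (simp add: power2_eq_square field_simps)
  moreover have "t\<^sup>2 * (norm (w - b))\<^sup>2 = (norm (t *\<^sub>R b - (t - 1) *\<^sub>R x k - z))\<^sup>2" for b
  proof -
    have "t\<^sup>2 * (norm (w - b))\<^sup>2 = (norm (t *\<^sub>R (b - w)))\<^sup>2"
      by (simp add: power_mult_distrib norm_minus_commute)
    also have "t *\<^sub>R (b - w) = t *\<^sub>R b - (t - 1) *\<^sub>R x k - z"
      by (simp add: scaleR_diff_right tw)
    finally show ?thesis .
  qed
  then have "t\<^sup>2 * (L / 2 * ((norm (w - y (Suc k)))\<^sup>2 - (norm (w - x (Suc k)))\<^sup>2))
      = L / 2 * (norm v)\<^sup>2 - L / 2 * (norm (t *\<^sub>R x (Suc k) - (t - 1) *\<^sub>R x k - z))\<^sup>2"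
    unfolding v_def by (simp add: algebra_simps)
  ultimately show ?case
    using IH unfolding t_def[symmetric] t'_def[symmetric] v' by linarith
qed

lemma accelerated_rate:
  assumes run: "accelerated_run N x y" and z: "z \<in> C" and "N \<ge> 1"
  shows "F z - F (x N) \<le> 2 * L * (norm (x 0 - z))\<^sup>2 / (real N + 1)\<^sup>2"
proof (cases "F z - F (x N) \<le> 0")
  case True
  also have "0 \<le> 2 * L * (norm (x 0 - z))\<^sup>2 / (real N + 1)\<^sup>2"
    using L_pos by simp
  finally show ?thesis .
next
  case False
  obtain m where N: "N = Suc m"
    using \<open>N \<ge> 1\<close> by (cases N) auto
  have "((real N + 1) / 2)\<^sup>2 \<le> (dfg_theta N)\<^sup>2"
    using dfg_theta_lower[of m] unfolding N by (intro power_mono) auto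
  then have "((real N + 1) / 2)\<^sup>2 * (F z - F (x N)) \<le> (dfg_theta N)\<^sup>2 * (F z - F (x N))"
    using False by (intro mult_right_mono) auto
  also have "\<dots> \<le> L / 2 * (norm (x 0 - z))\<^sup>2"
    using accelerated_potential[OF run z order.refl] L_pos
    by (smt (verit) divide_nonneg_nonneg mult_nonneg_nonneg zero_le_power2)
  also have "((real N + 1) / 2)\<^sup>2 * (F z - F (x N)) = (real N + 1)\<^sup>2 * (F z - F (x N)) / 4"
    by (simp add: power_divide)
  finally have "(real N + 1)\<^sup>2 * (F z - F (x N)) \<le> 2 * L * (norm (x 0 - z))\<^sup>2"
    by linarith
  then show ?thesis
    by (simp add: pos_le_divide_eq mult.commute)
qed

text \<open>
  The gain of one gradient step is at most the gap, so the error bound turns the distance in the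
  rate into the gap at the starting point.
\<close>

lemma accelerated_contraction:
  assumes run: "accelerated_run N x y" and "N \<ge> 1" and s: "s \<in> C"
    and err: "norm (x 0 - s) \<le> \<kappa> * norm (step (x 0) - x 0)"
    and max: "\<And>z. z \<in> C \<Longrightarrow> F z \<le> F s"
  shows "F s - F (x N) \<le> (2 * \<kappa> / (real N + 1))\<^sup>2 * (F s - F (x 0))"
proof -
  have x0: "x 0 \<in> C"
    using run by (simp add: accelerated_run_def)
  have "L / 2 * (norm (x 0 - s))\<^sup>2 \<le> L / 2 * (\<kappa>\<^sup>2 * (norm (step (x 0) - x 0))\<^sup>2)"
    using power_mono[OF err, of 2] L_pos by (simp add: power_mult_distrib)
  also have "\<dots> = \<kappa>\<^sup>2 * (L / 2 * (norm (step (x 0) - x 0))\<^sup>2)"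
    by simp
  also have "\<dots> \<le> \<kappa>\<^sup>2 * (F s - F (x 0))"
    using step_ascent[OF x0] max[OF step_in, of "x 0"] by (intro mult_left_mono) auto
  finally have dist: "L / 2 * (norm (x 0 - s))\<^sup>2 \<le> \<kappa>\<^sup>2 * (F s - F (x 0))" .
  have "F s - F (x N) \<le> 2 * L * (norm (x 0 - s))\<^sup>2 / (real N + 1)\<^sup>2"
    by (rule accelerated_rate[OF run s \<open>N \<ge> 1\<close>])
  also have "\<dots> \<le> 4 * (\<kappa>\<^sup>2 * (F s - F (x 0))) / (real N + 1)\<^sup>2"
    using dist by (intro divide_right_mono) auto
  also have "\<dots> = (2 * \<kappa> / (real N + 1))\<^sup>2 * (F s - F (x 0))"
    by (simp add: power_divide power_mult_distrib)
  finally show ?thesis .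
qed

end

section \<open>Regularity of the dual function\<close>

lemma strongly_convex_lagrangian:
  assumes "strongly_convex \<sigma> f"
  shows "strongly_convex \<sigma> (\<lambda>u. lagrangian f G g u x)"
  unfolding strongly_convex_def
proof (intro allI ballI)
  fix a b and t :: real
  assume t: "t \<in> {0..1}"
  have "x \<bullet> (G *v (t *\<^sub>R a + (1 - t) *\<^sub>R b) + g)
      = t * (x \<bullet> (G *v a + g)) + (1 - t) * (x \<bullet> (G *v b + g))"
    by (simp add: matrix_vector_right_distrib matrix_vector_mult_scaleR inner_add_right
        algebra_simps)
  moreover have "f (t *\<^sub>R a + (1 - t) *\<^sub>R b)
      \<le> t * f a + (1 - t) * f b - \<sigma> / 2 * t * (1 - t) * (norm (a - b))\<^sup>2"
    using assms t unfolding strongly_convex_def by blast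
  ultimately show "lagrangian f G g (t *\<^sub>R a + (1 - t) *\<^sub>R b) x
      \<le> t * lagrangian f G g a x + (1 - t) * lagrangian f G g b x
        - \<sigma> / 2 * t * (1 - t) * (norm (a - b))\<^sup>2"
    unfolding lagrangian_def by (simp add: algebra_simps)
qed

lemma dual_fun_attained:
  assumes "strongly_convex \<sigma> f" "\<sigma> > 0" "closed U" "U \<noteq> {}"
  obtains v where "v \<in> U" "dual_fun f G g U x = lagrangian f G g v x"
    "\<And>u. u \<in> U \<Longrightarrow> lagrangian f G g v x \<le> lagrangian f G g u x"
proof -
  obtain v where v: "v \<in> U" "\<And>u. u \<in> U \<Longrightarrow> lagrangian f G g v x \<le> lagrangian f G g u x"
    using strongly_convex_attains_min[OF strongly_convex_lagrangian[OF assms(1)] assms(2-4)]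
    by blast
  moreover from v have "dual_fun f G g U x = lagrangian f G g v x"
    unfolding dual_fun_def by (intro cInf_eq_minimum) auto
  ultimately show ?thesis
    using that by blast
qed

lemma dual_fun_le:
  assumes "strongly_convex \<sigma> f" "\<sigma> > 0" "closed U" "u \<in> U"
  shows "dual_fun f G g U x \<le> lagrangian f G g u x"
  using dual_fun_attained[OF assms(1-3)] assms(4) by (metis empty_iff)

lemma dual_lipschitz_pos:
  assumes "\<sigma> > 0" "G \<noteq> 0"
  shows "dual_lipschitz \<sigma> G > 0"
proof -
  have "(*v) G \<noteq> (\<lambda>u. 0)"
    using assms(2) by (metis matrix_eq matrix_vector_mult_0)
  then have "onorm ((*v) G) \<noteq> 0"
    by (subst onorm_eq_0) (auto simp: fun_eq_iff)
  then show ?thesis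
    using assms(1) by (simp add: dual_lipschitz_def)
qed

text \<open>
  Passing from \<open>y\<close> to \<open>z\<close> changes the Lagrangian at \<open>u\<close> by a term that differs from the one at the
  minimizer \<open>v\<close> only by \<open>(z - y) \<bullet> (G *v (u - v))\<close>. The quadratic growth around \<open>v\<close>
  absorbs it, at the price of \<open>onorm(G)\<^sup>2 norm(z - y)\<^sup>2 / (2 \<sigma>)\<close>.
\<close>

lemma smooth_bound_at_minimizer:
  assumes f: "strongly_convex \<sigma> f" and \<sigma>: "\<sigma> > 0" and U: "closed U" "convex U" "v \<in> U"
    and min: "\<And>u. u \<in> U \<Longrightarrow> lagrangian f G g v y \<le> lagrangian f G g u y"
  shows "lagrangian f G g v y - (G *v v + g) \<bullet> (z - y)
      - dual_lipschitz \<sigma> G / 2 * (norm (z - y))\<^sup>2 \<le> dual_fun f G g U z"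
proof -
  obtain u where u: "u \<in> U" "dual_fun f G g U z = lagrangian f G g u z"
    using dual_fun_attained[OF f \<sigma> U(1)] U(3) by (metis empty_iff)
  define a where "a = norm (u - v)"
  define b where "b = onorm ((*v) G) * norm (z - y)"
  have "lagrangian f G g v y + \<sigma> / 2 * a\<^sup>2 \<le> lagrangian f G g u y"
    unfolding a_def using strongly_convex_lagrangian[OF f] U(2,3) u(1) min
    by (rule strongly_convex_minimizer_growth)
  moreover have "lagrangian f G g u z
      = lagrangian f G g u y - (G *v v + g) \<bullet> (z - y) - (z - y) \<bullet> (G *v (u - v))"
    unfolding lagrangian_def
    by (simp add: matrix_vector_mult_diff_distrib inner_diff_left inner_diff_right
        inner_add_left inner_add_right inner_commute)
  moreover have "(z - y) \<bullet> (G *v (u - v)) \<le> a * b"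
  proof -
    have "(z - y) \<bullet> (G *v (u - v)) \<le> norm (z - y) * norm (G *v (u - v))"
      by (rule norm_cauchy_schwarz)
    also have "\<dots> \<le> norm (z - y) * (onorm ((*v) G) * norm (u - v))"
      by (intro mult_left_mono onorm) auto
    finally show ?thesis
      unfolding a_def b_def by (simp add: ac_simps)
  qed
  moreover have "a * b \<le> \<sigma> / 2 * a\<^sup>2 + b\<^sup>2 / (2 * \<sigma>)"
  proof -
    have "0 \<le> (\<sigma> * a - b)\<^sup>2"
      by simp
    then show ?thesis
      using \<sigma> by (simp add: field_simps power2_eq_square)
  qed
  moreover have "b\<^sup>2 / (2 * \<sigma>) = dual_lipschitz \<sigma> G / 2 * (norm (z - y))\<^sup>2"
    unfolding b_def dual_lipschitz_def by (simp add: power_mult_distrib)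
  ultimately show ?thesis
    unfolding u(2) by linarith
qed

lemma dual_cone_closed_convex: "closed (dual_cone K)" "convex (dual_cone K)" "0 \<in> dual_cone K"
proof -
  have eq: "dual_cone K = (\<Inter>z\<in>K. {x. z \<bullet> x \<ge> 0})"
    by (auto simp: dual_cone_def inner_commute)
  show "closed (dual_cone K)"
    unfolding eq by (intro closed_INT ballI closed_halfspace_ge)
  show "convex (dual_cone K)"
    unfolding eq by (intro convex_INT convex_halfspace_ge)
  show "0 \<in> dual_cone K"
    by (simp add: dual_cone_def)
qed

lemma weak_duality:
  assumes "strongly_convex \<sigma> f" "\<sigma> > 0" "closed U" "feasible_set G g K U \<noteq> {}"
    and "x \<in> dual_cone K"
  shows "dual_fun f G g U x \<le> opt_val f G g K U"
  unfolding opt_val_def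
proof (rule cINF_greatest[OF assms(4)])
  fix u assume "u \<in> feasible_set G g K U"
  then have "u \<in> U" "0 \<le> x \<bullet> (G *v u + g)"
    using assms(5) by (auto simp: feasible_set_def dual_cone_def)
  then show "dual_fun f G g U x \<le> f u"
    using dual_fun_le[OF assms(1-3), of u G g x] by (simp add: lagrangian_def)
qed

text \<open>
  No duality gap: by weak duality the multiplier attains the largest possible dual value.
\<close>

lemma dual_solutions_eq:
  assumes "strongly_convex \<sigma> f" "\<sigma> > 0" "closed U" "feasible_set G g K U \<noteq> {}"
    and "lagrange_multiplier f G g K U s"
  shows "dual_solutions f G g K U =
    {x \<in> dual_cone K. opt_val f G g K U \<le> dual_fun f G g U x}"
  using assms(5) weak_duality[OF assms(1-4)]
  unfolding dual_solutions_def lagrange_multiplier_def by fastforce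

text \<open>
  The supergradient at \<open>y\<close> is the derivative of the Lagrangian in its second argument at the
  minimizer for \<open>y\<close>: dropping minimality at \<open>z\<close> gives the upper bound.
\<close>

lemma dual_fun_smooth_concave:
  assumes f: "strongly_convex \<sigma> f" and \<sigma>: "\<sigma> > 0" and "G \<noteq> 0"
    and U: "closed U" "convex U" "U \<noteq> {}"
  shows "constrained_smooth_concave (dual_fun f G g U) (gradient (dual_fun f G g U))
    (dual_lipschitz \<sigma> G) (dual_cone K)"
proof -
  have "\<forall>y. \<exists>v\<in>U. dual_fun f G g U y = lagrangian f G g v y
      \<and> (\<forall>u\<in>U. lagrangian f G g v y \<le> lagrangian f G g u y)"
    using dual_fun_attained[OF f \<sigma> U(1,3)] by metis
  then obtain v where v: "\<And>y. v y \<in> U" "\<And>y. dual_fun f G g U y = lagrangian f G g (v y) y"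
    "\<And>y u. u \<in> U \<Longrightarrow> lagrangian f G g (v y) y \<le> lagrangian f G g u y"
    by metis
  define D where "D y = - (G *v v y + g)" for y
  interpret smooth_concave "dual_fun f G g U" D "dual_lipschitz \<sigma> G"
  proof
    show "dual_lipschitz \<sigma> G > 0"
      by (rule dual_lipschitz_pos[OF \<sigma> \<open>G \<noteq> 0\<close>])
    fix y z
    have "dual_fun f G g U z \<le> lagrangian f G g (v y) z"
      by (rule dual_fun_le[OF f \<sigma> U(1) v(1)])
    also have "\<dots> = dual_fun f G g U y + D y \<bullet> (z - y)"
      unfolding v(2)[of y] D_def lagrangian_def
      by (simp add: inner_diff_left inner_diff_right inner_add_left inner_add_right inner_commute)
    finally show "dual_fun f G g U z \<le> dual_fun f G g U y + D y \<bullet> (z - y)" .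
    have "lagrangian f G g (v y) y - (G *v v y + g) \<bullet> (z - y)
        - dual_lipschitz \<sigma> G / 2 * (norm (z - y))\<^sup>2 \<le> dual_fun f G g U z"
      by (rule smooth_bound_at_minimizer[OF f \<sigma> U(1,2) v(1)]) (rule v(3))
    then show "dual_fun f G g U y + D y \<bullet> (z - y) - dual_lipschitz \<sigma> G / 2 * (norm (z - y))\<^sup>2
        \<le> dual_fun f G g U z"
      unfolding D_def v(2)[of y] inner_minus_left by simp
  qed
  have "gradient (dual_fun f G g U) = D"
    by (rule ext) (rule gradient_eq)
  moreover have "constrained_smooth_concave (dual_fun f G g U) D (dual_lipschitz \<sigma> G) (dual_cone K)"
    by unfold_locales (use dual_cone_closed_convex in auto)
  ultimately show ?thesis
    by simp
qed

section \<open>Linear convergence under restarts\<close>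

theorem theorem5p4:
  fixes f :: "real^'n \<Rightarrow> real" and \<sigma> :: real and G :: "real^'n^'p" and g :: "real^'p"
    and K :: "(real^'p) set" and U :: "(real^'n) set"
    and \<kappa> :: real
    and u :: "nat \<Rightarrow> nat \<Rightarrow> real^'n" and x y :: "nat \<Rightarrow> nat \<Rightarrow> real^'p"
    and \<epsilon> :: real and p :: nat
  assumes "\<sigma> > 0" and "strongly_convex \<sigma> f"
    and "G \<noteq> 0"
    and "proper_cone K"
    and "U \<noteq> {}" and "closed U" and "convex U"
    and "feasible_set G g K U \<noteq> {}"
    and "\<exists>x. lagrange_multiplier f G g K U x"
    and "error_bound_property f \<sigma> G g K U"
    and "\<kappa> > 0"
    and "error_bound f \<sigma> G g K U (opt_val f G g K U - dual_fun f G g U (x 0 0)) \<kappa>"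
    and "restarted_dfg_run f \<sigma> G g K U (restart_interval \<kappa> (1 / exp 1)) u x y"
    and "\<epsilon> > 0" and "p \<ge> 1"
    and "infdist (x 0 0) (dual_solutions f G g K U) = 0 \<or>
         real (p * restart_interval \<kappa> (1 / exp 1))
           \<ge> exp 1 * \<kappa> *
             ln (dual_lipschitz \<sigma> G * (infdist (x 0 0) (dual_solutions f G g K U))\<^sup>2 / \<epsilon>)"
  shows "opt_val f G g K U - dual_fun f G g U (x (restart_interval \<kappa> (1 / exp 1)) (p - 1)) \<le> \<epsilon>"
proof -
  define d where "d = dual_fun f G g U"
  define C where "C = dual_cone K"
  define L where "L = dual_lipschitz \<sigma> G"
  define X where "X = dual_solutions f G g K U"
  define v where "v = opt_val f G g K U"
  define N where "N = restart_interval \<kappa> (1 / exp 1)"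
  interpret constrained_smooth_concave d "gradient d" L C
    unfolding d_def L_def C_def by (rule dual_fun_smooth_concave) (use assms in auto)
  have step: "projected_step f \<sigma> G g K U z = step z" for z
    unfolding step_def unfolding projected_step_def d_def L_def C_def ..
  have run: "accelerated_run N (\<lambda>k. x k j) (\<lambda>k. y k j)" and restart: "x 0 (Suc j) = x N j" for j
    using assms(13) unfolding accelerated_run_def
    unfolding N_def[symmetric] restarted_dfg_run_def dfg_run_def step C_def[symmetric]
    by (auto simp del: dfg_theta.simps)
  have x_in: "x 0 j \<in> C" for j
    using run[of j] by (simp add: accelerated_run_def)
  have max: "d z \<le> v" if "z \<in> C" for z
    using weak_duality[OF assms(2,1,6,8)] that unfolding d_def C_def v_def by blast
  obtain m where m: "lagrange_multiplier f G g K U m"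
    using assms(9) by blast
  have X_eq: "X = {z \<in> C. v \<le> d z}"
    unfolding X_def C_def v_def d_def by (rule dual_solutions_eq[OF assms(2,1,6,8) m])
  have opt: "s \<in> C" "d s = v" if "s \<in> X" for s
    using that max by (auto simp: X_eq intro: antisym)
  have X_nonempty: "X \<noteq> {}"
    using m unfolding X_eq C_def v_def d_def lagrange_multiplier_def by auto
  have "X = C \<inter> {z. v \<le> d z}"
    by (auto simp: X_eq)
  then have X_closed: "closed X"
    using C_closed continuous by (simp add: closed_Int closed_Collect_le continuous_on_const)
  have last: "x N (p - 1) = x 0 p"
    using restart[of "p - 1"] \<open>p \<ge> 1\<close> by simp
  define R where "R = infdist (x 0 0) X"
  have "v - d (x 0 p) \<le> \<epsilon>"
  proof (cases "R = 0")
    case True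
    \<comment> \<open>A small \<kappa> is possible here, and then the restart interval may be 0.\<close>
    have "x 0 j \<in> X" for j
    proof (induction j)
      case 0
      show ?case
        using True in_closed_iff_infdist_zero[OF X_closed X_nonempty] by (simp add: R_def)
    next
      case (Suc j)
      show ?case
      proof (cases "N = 0")
        case True
        then show ?thesis
          using restart[of j] Suc by simp
      next
        case False
        then have "d (x 0 j) - d (x N j) \<le> 0"
          using accelerated_rate[OF run x_in, of j j] by simp
        then show ?thesis
          using x_in[of "Suc j"] opt(2)[OF Suc] restart[of j] by (simp add: X_eq)
      qed
    qed
    then show ?thesis
      using opt(2) \<open>\<epsilon> > 0\<close> by simp
  next
    case False
    then have R: "R > 0"
      using infdist_nonneg[of "x 0 0" X] by (simp add: R_def)
    obtain s where s: "s \<in> X" "norm (x 0 0 - s) = R"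
      using infdist_attains_inf[OF X_closed X_nonempty, of "x 0 0"] by (metis R_def dist_norm)
    have err: "norm (x 0 j - closest_point X (x 0 j)) \<le> \<kappa> * norm (step (x 0 j) - x 0 j)"
      if "d (x 0 0) \<le> d (x 0 j)" for j
      using assms(12) x_in[of j] that
      unfolding error_bound_def gradient_map_def step C_def X_def d_def by simp
    have proj: "closest_point X z \<in> X" for z
      by (rule closest_point_in_set[OF X_closed X_nonempty])
    \<comment> \<open>The error bound at the starting point, which is not optimal, excludes small values of \<kappa>.\<close>
    have "R \<le> norm (x 0 0 - closest_point X (x 0 0))"
      unfolding R_def using infdist_le[OF proj] by (simp add: dist_norm)
    also have "\<dots> \<le> \<kappa> * norm (step (x 0 0) - x 0 0)"
      by (rule err) simp
    finally have "R\<^sup>2 \<le> \<kappa>\<^sup>2 * (norm (step (x 0 0) - x 0 0))\<^sup>2"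
      using R by (metis power_mono power_mult_distrib less_imp_le)
    also have "\<dots> \<le> \<kappa>\<^sup>2 * (2 * R\<^sup>2)"
      using step_displacement[of s "x 0 0"] opt[OF s(1)] max s(2)
      by (intro mult_left_mono) (simp_all add: norm_minus_commute)
    finally have \<kappa>_large: "1 \<le> 2 * \<kappa>\<^sup>2"
      using R by simp
    have N_floor: "N = nat \<lfloor>2 * exp 1 * \<kappa>\<rfloor>"
      unfolding N_def restart_interval_def by (simp add: mult_ac)
    have N_upper: "real N \<le> 2 * exp 1 * \<kappa>"
      unfolding N_floor using \<open>\<kappa> > 0\<close> by (simp add: of_nat_nat)
    have N_lower: "2 * exp 1 * \<kappa> \<le> real N + 1"
      unfolding N_floor using \<open>\<kappa> > 0\<close> by linarith
    have "(2 * exp 1 * \<kappa>)\<^sup>2 \<le> (real N + 1)\<^sup>2"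
      using N_lower \<open>\<kappa> > 0\<close> by (intro power_mono) auto
    moreover have "(2 * exp 1 * \<kappa>)\<^sup>2 = exp 2 * (4 * \<kappa>\<^sup>2)"
      by (simp add: power_mult_distrib flip: exp_double)
    ultimately have N_square: "exp 2 * (4 * \<kappa>\<^sup>2) \<le> (real N + 1)\<^sup>2"
      by simp
    have N_two: "exp 2 * 2 \<le> (real N + 1)\<^sup>2"
      by (rule order_trans[OF _ N_square]) (use \<kappa>_large in simp)
    have "N \<noteq> 0"
    proof
      assume "N = 0"
      then have "exp 2 * 2 \<le> (1::real)"
        using N_two by simp
      then show False
        using exp_ge_add_one_self[of "2::real"] by simp
    qed
    then have N1: "N \<ge> 1"
      by simp
    have contraction: "v - d (x 0 (Suc j)) \<le> exp (- 2) * (v - d (x 0 j))"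
      if "d (x 0 0) \<le> d (x 0 j)" for j
    proof -
      have "v - d (x 0 (Suc j)) \<le> (2 * \<kappa> / (real N + 1))\<^sup>2 * (v - d (x 0 j))"
        using accelerated_contraction[OF run N1 opt(1)[OF proj] err[OF that]] max
        by (simp add: opt(2)[OF proj] restart)
      also have "(2 * \<kappa> / (real N + 1))\<^sup>2 \<le> exp (- 2)"
        using N_square by (simp add: power_divide power_mult_distrib exp_minus field_simps)
      finally show ?thesis
        using max[OF x_in, of j] by (simp add: mult_right_mono)
    qed
    have monotone: "d (x 0 0) \<le> d (x 0 j)" for j
    proof (induction j)
      case (Suc j)
      have "exp (- 2) * (v - d (x 0 j)) \<le> 1 * (v - d (x 0 j))"
        using max[OF x_in, of j] by (intro mult_right_mono) auto
      then show ?case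
        using contraction[OF Suc] Suc by simp
    qed simp
    have first: "v - d (x 0 1) \<le> exp (- 2) * (L * R\<^sup>2)"
    proof -
      have "v - d (x 0 1) \<le> 2 * L * R\<^sup>2 / (real N + 1)\<^sup>2"
        using accelerated_rate[OF run opt(1)[OF s(1)] N1, of 0] restart[of 0]
        by (simp add: opt(2)[OF s(1)] s(2))
      also have "\<dots> \<le> 2 * L * R\<^sup>2 / (exp 2 * 2)"
        using N_two L_pos by (intro divide_left_mono) auto
      also have "\<dots> = exp (- 2) * (L * R\<^sup>2)"
        by (simp add: exp_minus field_simps)
      finally show ?thesis .
    qed
    have decay: "v - d (x 0 (Suc j)) \<le> exp (- 2 * real (Suc j)) * (L * R\<^sup>2)" for j
    proof (induction j)
      case 0
      show ?case
        using first by simp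
    next
      case (Suc j)
      have "v - d (x 0 (Suc (Suc j))) \<le> exp (- 2) * (v - d (x 0 (Suc j)))"
        by (rule contraction[OF monotone])
      also have "\<dots> \<le> exp (- 2) * (exp (- 2 * real (Suc j)) * (L * R\<^sup>2))"
        by (rule mult_left_mono[OF Suc]) simp
      also have "\<dots> = exp (- 2 * real (Suc (Suc j))) * (L * R\<^sup>2)"
      proof -
        have "exp (- 2) * exp (- 2 * real (Suc j)) = exp (- 2 * real (Suc (Suc j)))"
          unfolding exp_add[symmetric] by (rule arg_cong[of _ _ exp]) simp
        then show ?thesis
          by (simp only: mult.assoc[symmetric])
      qed
      finally show ?case .
    qed
    have "exp 1 * \<kappa> * ln (L * R\<^sup>2 / \<epsilon>) \<le> real p * real N"
      using assms(16) R unfolding R_def L_def X_def N_def by simp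
    also have "\<dots> \<le> real p * (2 * exp 1 * \<kappa>)"
      by (rule mult_left_mono[OF N_upper]) simp
    finally have "exp 1 * \<kappa> * ln (L * R\<^sup>2 / \<epsilon>) \<le> exp 1 * \<kappa> * (2 * real p)"
      by (simp add: mult_ac)
    then have "ln (L * R\<^sup>2 / \<epsilon>) \<le> 2 * real p"
      using \<open>\<kappa> > 0\<close> by simp
    then have "L * R\<^sup>2 / \<epsilon> \<le> exp (2 * real p)"
      using L_pos R \<open>\<epsilon> > 0\<close>
      by (metis divide_pos_pos exp_le_cancel_iff exp_ln mult_pos_pos zero_less_power)
    then have "exp (- 2 * real p) * (L * R\<^sup>2) \<le> \<epsilon>"
      using \<open>\<epsilon> > 0\<close> by (simp add: exp_minus field_simps)
    with decay[of "p - 1"] \<open>p \<ge> 1\<close> show ?thesis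
      by simp
  qed
  then show ?thesis
    unfolding last[symmetric] v_def d_def N_def .
qed

end
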